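(* Assume: (a) $U(u,t)$ is nondecreasing in $u$ and in $t$, and $\lim_{t\to+\infty}U(u,t)=+\infty$ for every $u\ge 0$; (b) there exist constants $u_*\ge 0$, $c_*>0$, $L>0$ such that $U(u,t)\ge u+c_*t$ for all $u\ge u_*$, $t\ge 0$, and $$\int_0^{+\infty}e^{Lz}\,dF(z)\int_0^{+\infty}e^{-c_*Lt}\,dK(t)\le 1;$$ (c) $K(t)\,F(z)<1$ for all $t,z\ge 0$. Put $\varphi_*(u)=\max\{0,1-e^{-L(u-u_* )}\}$. Then: 1) the equation $\varphi=A\varphi$ has a nondecreasing solution $\varphi$ with $1\ge\varphi(u)\ge\varphi_*(u)$ for all $u\ge 0$; 2) $\varphi$ is the unique nondecreasing solution $[0,+\infty)\to[0,1]$ of $\varphi=A\varphi$ satisfying $\lim_{u\to+\infty}\varphi(u)=1$; 3) the sequence $\varphi^{k+1}=A\varphi^k$, $k=0,1,\dots$, started from $\varphi^0\equiv 1$ converges pointwise to $\varphi$ monotonically from above, and started from $\varphi^0=\varphi_*$ converges pointwise to $\varphi$ monotonically from below; 4) for any initial function $\varphi^0$ with $1\ge\varphi^0(u)\ge\varphi_*(u)$ for all $u\ge0$, the sequence $\varphi^{k+1}=A\varphi^k$ converges pointwise to $\varphi$.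
   Context: Let $F$ be the distribution function of a claim size ($F(z)=0$ for $z\le 0$) and $K$ the distribution function of the (nonnegative) time between successive claims. Let $c(\cdot)\ge 0$ be a piecewise continuous premium rate and let $U(u,t)$, $u,t\ge0$, be the solution of the Cauchy problem $dU/dt=c(U)$, $U(u,0)=u$ (the reserve at time $t$ in the absence of claims), assumed well defined for all $t\ge 0$. The operator $A$ acts on bounded Borel functions $\varphi:[0,+\infty)\to\mathbb R$ by $$A\varphi(u)=\int_0^{+\infty}\int_0^{U(u,t)}\varphi(U(u,t)-z)\,dF(z)\,dK(t),\qquad u\ge 0,$$ where integrals are Lebesgue–Stieltjes integrals and endpoints of the integration intervals are included. All initial functions are Borel measurable. *)

theory Defs
  imports "HOL-Probability.Probability"
begin

definition distribution_function :: "(real \<Rightarrow> real) \<Rightarrow> bool" where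
  "distribution_function F \<longleftrightarrow>
     mono F \<and> (\<forall>x. continuous (at_right x) F) \<and>
     (F \<longlongrightarrow> 0) at_bot \<and> (F \<longlongrightarrow> 1) at_top"

text \<open>On \<open>[0,\<infinity>)\<close>: finitely many discontinuities in each bounded interval, with finite
  one-sided limits everywhere.\<close>

definition piecewise_continuous :: "(real \<Rightarrow> real) \<Rightarrow> bool" where
  "piecewise_continuous c \<longleftrightarrow>
     (\<exists>D. (\<forall>b. finite (D \<inter> {0..b})) \<and> continuous_on ({0..} - D) c) \<and>
     (\<forall>x\<ge>0. \<exists>l. (c \<longlongrightarrow> l) (at_right x)) \<and>
     (\<forall>x>0. \<exists>l. (c \<longlongrightarrow> l) (at_left x))"

text \<open>Since \<open>c\<close> may jump, a solution of \<open>dy/dt = c(y)\<close>, \<open>y(0) = u\<close> may have kinks: it is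
  continuous, and the equation holds outside a set of times with finitely many elements in each
  bounded interval.\<close>

definition cauchy_solution :: "(real \<Rightarrow> real) \<Rightarrow> real \<Rightarrow> (real \<Rightarrow> real) \<Rightarrow> bool" where
  "cauchy_solution c u y \<longleftrightarrow>
     y 0 = u \<and> (\<forall>t\<ge>0. y t \<ge> 0) \<and> continuous_on {0..} y \<and>
     (\<exists>S. (\<forall>b. finite (S \<inter> {0..b})) \<and>
          (\<forall>t\<in>{0..} - S. (y has_real_derivative c (y t)) (at t within {0..})))"

definition reserve_flow :: "(real \<Rightarrow> real) \<Rightarrow> (real \<Rightarrow> real \<Rightarrow> real) \<Rightarrow> bool" where
  "reserve_flow c U \<longleftrightarrow>
     (\<forall>u\<ge>0. cauchy_solution c u (U u) \<and>
            (\<forall>y. cauchy_solution c u y \<longrightarrow> (\<forall>t\<ge>0. y t = U u t)))"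

text \<open>Functions on \<open>[0,\<infinity>)\<close> are represented by functions on the reals; for \<open>u \<ge> 0\<close> and
  \<open>U u t \<ge> 0\<close> the value at \<open>u\<close> depends only on the restriction of \<open>\<phi>\<close> to \<open>[0,\<infinity>)\<close>.\<close>

definition risk_op ::
  "(real \<Rightarrow> real) \<Rightarrow> (real \<Rightarrow> real) \<Rightarrow> (real \<Rightarrow> real \<Rightarrow> real) \<Rightarrow> (real \<Rightarrow> real) \<Rightarrow> real \<Rightarrow> real" where
  "risk_op F K U \<phi> u =
     (LINT t:{0..}|interval_measure K. (LINT z:{0..U u t}|interval_measure F. \<phi> (U u t - z)))"

definition phi_star :: "real \<Rightarrow> real \<Rightarrow> real \<Rightarrow> real" where
  "phi_star L u\<^sub>0 u = max 0 (1 - exp (- L * (u - u\<^sub>0)))"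

end

theory Submission
  imports Defs
begin

text \<open>
  With \<open>T\<close> and \<open>Z\<close> independent of laws \<open>K\<close> and \<open>F\<close>, the operator is
  \<open>A \<phi> u = E [\<phi> (U u T - Z); Z \<le> U u T]\<close>, a monotone sub-Markov operator that is continuous along
  bounded pointwise limits. Hence \<open>A 1 \<le> 1\<close>, and the exponential moment condition gives
  \<open>\<phi>\<^sub>* \<le> A \<phi>\<^sub>*\<close>, so the iterates of \<open>1\<close> and of \<open>\<phi>\<^sub>*\<close> converge monotonically to fixed points tending to
  \<open>1\<close> at infinity. Two such fixed points coincide: if \<open>s > 0\<close> is the supremum of their distance
  \<open>\<delta>\<close> and \<open>\<delta> \<le> s/2\<close> beyond \<open>B\<close>, then \<open>\<delta> \<le> A \<delta>\<close>, and from every \<open>u \<le> B\<close> a single step leaves \<open>[0, B]\<close>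
  with probability bounded below, by ruin when \<open>F < 1\<close> everywhere and by escape above \<open>B\<close> when \<open>K < 1\<close>
  everywhere. One of the two holds because \<open>K t * F z < 1\<close>. All other iterations are squeezed
  between those of \<open>\<phi>\<^sub>*\<close> and \<open>1\<close>.
\<close>

section \<open>Probability laws given by distribution functions\<close>

lemma real_distribution_distribution_function:
  assumes "distribution_function F"
  shows "real_distribution (interval_measure F)"
  using assms unfolding distribution_function_def
  by (intro real_distribution_interval_measure) (auto dest: monoD)

lemma measure_distribution_function_Iic:
  assumes "distribution_function F"
  shows "measure (interval_measure F) {..x} = F x"
  using assms unfolding distribution_function_def
  by (intro measure_interval_measure_Iic) (auto dest: monoD)

lemma distribution_function_le_1: "distribution_function G \<Longrightarrow> G x \<le> 1"
  using measure_distribution_function_Iic[of G x] real_distribution_distribution_function[of G]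
  by (metis prob_space.prob_le_1 real_distribution.axioms(1))

lemma distribution_function_pos:
  assumes "distribution_function G"
  obtains x where "0 \<le> x" "0 < G x"
proof -
  have "\<forall>\<^sub>F x in at_top. 0 < G x"
    using assms by (auto simp: distribution_function_def intro: order_tendstoD)
  then have "\<forall>\<^sub>F x in at_top. 0 \<le> x \<and> 0 < G x"
    using eventually_ge_at_top[of 0] by eventually_elim auto
  then show ?thesis
    using that eventually_happens'[OF trivial_limit_at_top_linorder] by blast
qed

lemma measure_distribution_function_Ioi:
  assumes "distribution_function G"
  shows "measure (interval_measure G) {x<..} = 1 - G x"
proof -
  interpret real_distribution "interval_measure G"
    using assms by (rule real_distribution_distribution_function)
  have "{x<..} = space (interval_measure G) - {..x}" by auto
  then show ?thesis
    using prob_compl[of "{..x}"] measure_distribution_function_Iic[OF assms] by simp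
qed

lemma mono_on_limit:
  fixes f :: "nat \<Rightarrow> real \<Rightarrow> real"
  assumes "\<And>k. mono_on {0..} (f k)" "\<And>x. 0 \<le> x \<Longrightarrow> (\<lambda>k. f k x) \<longlonglongrightarrow> \<phi> x"
  shows "mono_on {0..} \<phi>"
proof (rule mono_onI)
  fix u v :: real assume "u \<in> {0..}" "v \<in> {0..}" "u \<le> v"
  then show "\<phi> u \<le> \<phi> v"
    using assms(2) mono_onD[OF assms(1)]
    by (intro LIMSEQ_le[of "\<lambda>k. f k u" _ "\<lambda>k. f k v"]) auto
qed

text \<open>The negative half-line is the countable union of the sets
  \<open>{..- inverse (real (Suc n))}\<close>, each of mass zero. Right-continuity does not force
  \<open>F 0 = 0\<close> here, so an atom at 0 is permitted, as the law of the waiting time may have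
  one.\<close>

lemma AE_distribution_function_nonneg:
  assumes F: "distribution_function F" and neg: "\<And>x. x < 0 \<Longrightarrow> F x = 0"
  shows "AE x in interval_measure F. 0 \<le> x"
proof -
  interpret real_distribution "interval_measure F"
    using F by (rule real_distribution_distribution_function)
  have "AE x in interval_measure F. - inverse (real (Suc n)) < x" for n
  proof (rule AE_I)
    show "emeasure (interval_measure F) {..- inverse (real (Suc n))} = 0"
      using measure_distribution_function_Iic[OF F] neg[of "- inverse (real (Suc n))"]
      by (simp add: emeasure_eq_measure)
  qed auto
  then have "AE x in interval_measure F. \<forall>n. - inverse (real (Suc n)) < x"
    by (simp add: AE_all_countable)
  then show ?thesis
  proof eventually_elim
    case (elim x)
    show ?case
    proof (rule ccontr)
      assume "\<not> 0 \<le> x"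
      then obtain n where "inverse (real (Suc n)) < - x"
        using reals_Archimedean[of "- x"] by auto
      with elim[rule_format, of n] show False by linarith
    qed
  qed
qed

text \<open>Round the second argument down to the grid of mesh \<open>1 / Suc n\<close>. The rounded
  function is glued from countably many functions measurable in the first argument, and continuity
  in the second argument recovers \<open>f\<close> as the pointwise limit.\<close>

lemma borel_measurable_Caratheodory_real:
  fixes f :: "'a \<Rightarrow> real \<Rightarrow> real"
  assumes meas: "\<And>t. (\<lambda>x. f x t) \<in> borel_measurable M"
    and cont: "\<And>x. x \<in> space M \<Longrightarrow> continuous_on UNIV (f x)"
  shows "(\<lambda>p. f (fst p) (snd p)) \<in> borel_measurable (M \<Otimes>\<^sub>M borel)"
proof (rule borel_measurable_LIMSEQ_real)
  let ?g = "\<lambda>n p. f (fst p) (real_of_int \<lfloor>real (Suc n) * snd p\<rfloor> / real (Suc n))"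
  show "?g n \<in> borel_measurable (M \<Otimes>\<^sub>M borel)" for n
  proof (rule measurable_compose_countable[where f = "\<lambda>i p. f (fst p) (real_of_int i / real (Suc n))"])
    show "(\<lambda>p. f (fst p) (real_of_int i / real (Suc n))) \<in> borel_measurable (M \<Otimes>\<^sub>M borel)" for i
      by (rule measurable_compose[OF measurable_fst meas])
    show "(\<lambda>p::'a \<times> real. \<lfloor>real (Suc n) * snd p\<rfloor>) \<in> M \<Otimes>\<^sub>M borel \<rightarrow>\<^sub>M count_space UNIV"
      by measurable
  qed
  fix p assume p: "p \<in> space (M \<Otimes>\<^sub>M (borel :: real measure))"
  have "(\<lambda>n. real_of_int \<lfloor>real (Suc n) * snd p\<rfloor> / real (Suc n)) \<longlonglongrightarrow> snd p"
  proof (rule tendsto_sandwich[where f = "\<lambda>n. snd p - inverse (real (Suc n))" and h = "\<lambda>n. snd p"])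
    have "snd p - inverse (real (Suc n)) \<le> real_of_int \<lfloor>real (Suc n) * snd p\<rfloor> / real (Suc n)
        \<and> real_of_int \<lfloor>real (Suc n) * snd p\<rfloor> / real (Suc n) \<le> snd p" for n
    proof -
      have "real (Suc n) * snd p - 1 \<le> real_of_int \<lfloor>real (Suc n) * snd p\<rfloor>"
        "real_of_int \<lfloor>real (Suc n) * snd p\<rfloor> \<le> real (Suc n) * snd p"
        by linarith+
      then have "(real (Suc n) * snd p - 1) / real (Suc n)
            \<le> real_of_int \<lfloor>real (Suc n) * snd p\<rfloor> / real (Suc n)"
        "real_of_int \<lfloor>real (Suc n) * snd p\<rfloor> / real (Suc n) \<le> real (Suc n) * snd p / real (Suc n)"
        by (intro divide_right_mono; simp)+
      then show ?thesis by (simp add: diff_divide_distrib inverse_eq_divide)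
    qed
    then show "\<forall>\<^sub>F n in sequentially. snd p - inverse (real (Suc n))
        \<le> real_of_int \<lfloor>real (Suc n) * snd p\<rfloor> / real (Suc n)"
      "\<forall>\<^sub>F n in sequentially. real_of_int \<lfloor>real (Suc n) * snd p\<rfloor> / real (Suc n) \<le> snd p"
      by auto
    show "(\<lambda>n. snd p - inverse (real (Suc n))) \<longlonglongrightarrow> snd p"
      using tendsto_diff[OF tendsto_const LIMSEQ_inverse_real_of_nat, of "snd p"] by simp
  qed simp
  moreover have "isCont (f (fst p)) (snd p)"
    using cont[of "fst p"] p by (auto simp: continuous_on_eq_continuous_at space_pair_measure)
  ultimately show "(\<lambda>n. ?g n p) \<longlonglongrightarrow> f (fst p) (snd p)"
    by (rule isCont_tendsto_compose[rotated])
qed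

section \<open>The risk model and its operator as an expectation over a product law\<close>

locale risk_model =
  fixes F K :: "real \<Rightarrow> real" and U :: "real \<Rightarrow> real \<Rightarrow> real"
  assumes F_dist: "distribution_function F" and K_dist: "distribution_function K"
    and U_nonneg: "\<And>u t. 0 \<le> u \<Longrightarrow> 0 \<le> t \<Longrightarrow> 0 \<le> U u t"
    and U_cont: "\<And>u. 0 \<le> u \<Longrightarrow> continuous_on {0..} (U u)"
    and U_mono: "\<And>u v t. 0 \<le> u \<Longrightarrow> u \<le> v \<Longrightarrow> 0 \<le> t \<Longrightarrow> U u t \<le> U v t"

sublocale risk_model \<subseteq> K: real_distribution "interval_measure K"
  using K_dist by (rule real_distribution_distribution_function)

sublocale risk_model \<subseteq> F: real_distribution "interval_measure F"
  using F_dist by (rule real_distribution_distribution_function)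

sublocale risk_model \<subseteq> pair_prob_space "interval_measure K" "interval_measure F"
  by unfold_locales

context risk_model
begin

abbreviation A :: "(real \<Rightarrow> real) \<Rightarrow> real \<Rightarrow> real" where
  "A \<equiv> risk_op F K U"

abbreviation P :: "(real \<times> real) measure" where
  "P \<equiv> interval_measure K \<Otimes>\<^sub>M interval_measure F"

text \<open>The class on which \<open>A\<close> is iterated. Measurability is asked on the
  restricted space because values at negative arguments are arbitrary and never reach the
  operator.\<close>

definition admissible :: "(real \<Rightarrow> real) \<Rightarrow> bool" where
  "admissible \<phi> \<longleftrightarrow> \<phi> \<in> borel_measurable (restrict_space borel {0..}) \<and> (\<forall>u\<ge>0. 0 \<le> \<phi> u \<and> \<phi> u \<le> 1)"

text \<open>Value of \<open>\<phi>\<close> at the reserve just after a claim of size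
  \<open>snd p\<close> at time \<open>fst p\<close>, with 0 standing for ruin. The sign guards
  reproduce the two integration ranges of \<open>risk_op\<close>.\<close>

definition claim_integrand :: "(real \<Rightarrow> real) \<Rightarrow> real \<Rightarrow> real \<times> real \<Rightarrow> real" where
  "claim_integrand \<phi> u p =
    (if 0 \<le> fst p \<and> 0 \<le> snd p \<and> snd p \<le> U u (fst p) then \<phi> (U u (fst p) - snd p) else 0)"

lemma sets_P: "sets P = sets (borel \<Otimes>\<^sub>M borel)"
  by (intro sets_pair_measure_cong) auto

lemma space_P: "space P = UNIV"
  by (simp add: space_pair_measure)

text \<open>The flow is Borel in \<open>u\<close> by monotonicity and continuous in
  \<open>t\<close>. Clamping at 0 extends it to the whole plane.\<close>

lemma U_joint_measurable:
  "(\<lambda>p. U (max 0 (fst p)) (max 0 (snd p))) \<in> borel_measurable (borel \<Otimes>\<^sub>M borel)"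
proof (rule borel_measurable_Caratheodory_real[where f = "\<lambda>u t. U (max 0 u) (max 0 t)"])
  show "(\<lambda>u. U (max 0 u) (max 0 t)) \<in> borel_measurable borel" for t
    by (rule borel_measurable_mono) (auto intro!: monoI U_mono)
  show "continuous_on UNIV (\<lambda>t. U (max 0 u) (max 0 t))" for u
    by (rule continuous_on_compose2[OF U_cont]) (auto intro!: continuous_intros)
qed

text \<open>Measurability jointly with \<open>u\<close> is what makes \<open>A \<phi>\<close>
  measurable again, so that \<open>A\<close> can be iterated.\<close>

lemma claim_integrand_joint_measurable:
  assumes "\<phi> \<in> borel_measurable (restrict_space borel {0..})"
  shows "(\<lambda>q. claim_integrand \<phi> (max 0 (fst q)) (snd q)) \<in> borel_measurable (borel \<Otimes>\<^sub>M P)"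
proof -
  \<comment> \<open>Extension of \<open>\<phi>\<close> by zero: since \<open>g\<close> vanishes at
    negative reserves, it encodes the ruin condition and leaves only the sign guards on time and
    claim.\<close>
  define g where "g x = (if x \<in> {0..} then \<phi> x else 0)" for x :: real
  have g[measurable]: "g \<in> borel_measurable borel"
    using assms unfolding g_def
    by (subst (asm) measurable_restrict_space_iff[where c = 0]) auto
  have V: "(\<lambda>q. U (max 0 (fst q)) (max 0 (fst (snd q)))) \<in> borel_measurable (borel \<Otimes>\<^sub>M (borel \<Otimes>\<^sub>M borel))"
    by (rule measurable_compose[OF _ U_joint_measurable,
          where f = "\<lambda>q. (fst q, fst (snd q))", simplified]) measurable
  note [measurable] = V
  have "(\<lambda>q. if 0 \<le> fst (snd q) \<and> 0 \<le> snd (snd q)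
      then g (U (max 0 (fst q)) (max 0 (fst (snd q))) - snd (snd q)) else 0)
    \<in> borel_measurable (borel \<Otimes>\<^sub>M (borel \<Otimes>\<^sub>M borel))"
    by measurable
  also have "(\<lambda>q. if 0 \<le> fst (snd q) \<and> 0 \<le> snd (snd q)
      then g (U (max 0 (fst q)) (max 0 (fst (snd q))) - snd (snd q)) else 0)
    = (\<lambda>q. claim_integrand \<phi> (max 0 (fst q)) (snd q))"
    by (auto simp: fun_eq_iff claim_integrand_def g_def max_def)
  also have "borel_measurable (borel \<Otimes>\<^sub>M (borel \<Otimes>\<^sub>M borel)) = borel_measurable (borel \<Otimes>\<^sub>M P)"
    by (intro measurable_cong_sets sets_pair_measure_cong) (auto simp: sets_P)
  finally show ?thesis .
qed

lemma claim_integrand_measurable: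
  assumes "\<phi> \<in> borel_measurable (restrict_space borel {0..})" "0 \<le> u"
  shows "claim_integrand \<phi> u \<in> borel_measurable P"
  using measurable_compose[OF measurable_Pair1' claim_integrand_joint_measurable[OF assms(1)], of u]
    assms(2) by (simp add: max_def)

lemma integrable_claim_integrand:
  assumes "admissible \<phi>" "0 \<le> u"
  shows "integrable P (claim_integrand \<phi> u)"
  using assms by (intro P.integrable_const_bound[where B = 1] claim_integrand_measurable AE_I2)
    (auto simp: admissible_def claim_integrand_def)

text \<open>Fubini for a bounded integrand on a probability space. It reduces order and limit
  properties of \<open>A\<close> to pointwise facts about \<open>claim_integrand\<close>.\<close>

lemma risk_op_eq:
  assumes "admissible \<phi>" "0 \<le> u"
  shows "A \<phi> u = (\<integral>p. claim_integrand \<phi> u p \<partial>P)"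
proof -
  have "A \<phi> u = (\<integral>t. \<integral>z. claim_integrand \<phi> u (t, z) \<partial>interval_measure F \<partial>interval_measure K)"
    unfolding risk_op_def set_lebesgue_integral_def
  proof (intro Bochner_Integration.integral_cong refl)
    fix t
    show "indicator {0..} t *\<^sub>R
        (LINT z|interval_measure F. indicator {0..U u t} z *\<^sub>R \<phi> (U u t - z)) =
        (\<integral>z. claim_integrand \<phi> u (t, z) \<partial>interval_measure F)"
      by (cases "0 \<le> t")
        (auto simp: claim_integrand_def indicator_def intro!: Bochner_Integration.integral_cong)
  qed
  also have "\<dots> = (\<integral>p. claim_integrand \<phi> u p \<partial>P)"
    using integrable_claim_integrand[OF assms] by (rule integral_fst')
  finally show ?thesis .
qed

lemma claim_integrand_mono:
  assumes "\<And>x. 0 \<le> x \<Longrightarrow> \<phi> x \<le> \<psi> x"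
  shows "claim_integrand \<phi> u p \<le> claim_integrand \<psi> u p"
  using assms by (auto simp: claim_integrand_def)

lemma risk_op_mono:
  assumes "admissible \<phi>" "admissible \<psi>" "\<And>x. 0 \<le> x \<Longrightarrow> \<phi> x \<le> \<psi> x" "0 \<le> u"
  shows "A \<phi> u \<le> A \<psi> u"
  unfolding risk_op_eq[OF assms(1,4)] risk_op_eq[OF assms(2,4)]
  using assms by (intro integral_mono integrable_claim_integrand claim_integrand_mono) auto

lemma admissible_risk_op:
  assumes "admissible \<phi>"
  shows "admissible (A \<phi>)"
  unfolding admissible_def
proof (intro conjI allI impI)
  note [measurable] =
    claim_integrand_joint_measurable[of \<phi>, OF assms[unfolded admissible_def, THEN conjunct1]]
  have "(\<lambda>u. \<integral>p. claim_integrand \<phi> (max 0 u) p \<partial>P) \<in> borel_measurable borel"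
    by (rule P.borel_measurable_lebesgue_integral) (simp add: split_beta')
  then have "(\<lambda>u. \<integral>p. claim_integrand \<phi> (max 0 u) p \<partial>P) \<in> borel_measurable (restrict_space borel {0..})"
    by (rule measurable_restrict_space1)
  also have "?this \<longleftrightarrow> A \<phi> \<in> borel_measurable (restrict_space borel {0..})"
    by (intro measurable_cong) (auto simp: space_restrict_space risk_op_eq[OF assms] max_def)
  finally show "A \<phi> \<in> borel_measurable (restrict_space borel {0..})" .
  fix u :: real assume u: "0 \<le> u"
  have bounds: "0 \<le> claim_integrand \<phi> u p \<and> claim_integrand \<phi> u p \<le> 1" for p
    using assms by (auto simp: claim_integrand_def admissible_def)
  show "0 \<le> A \<phi> u"
    unfolding risk_op_eq[OF assms u] using bounds by (intro Bochner_Integration.integral_nonneg) auto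
  show "A \<phi> u \<le> 1"
    unfolding risk_op_eq[OF assms u]
    using bounds by (intro P.integral_le_const integrable_claim_integrand assms u) auto
qed

lemma admissible_funpow_risk_op: "admissible \<phi> \<Longrightarrow> admissible ((A ^^ k) \<phi>)"
  by (induction k) (auto intro: admissible_risk_op)

text \<open>A larger initial reserve survives every claim that a smaller one survives and retains at
  least as much afterwards. Where the smaller one is ruined, its integrand is 0.\<close>

lemma mono_on_risk_op:
  assumes "admissible \<phi>" "mono_on {0..} \<phi>"
  shows "mono_on {0..} (A \<phi>)"
proof (rule mono_onI)
  fix u v :: real assume uv: "u \<in> {0..}" "v \<in> {0..}" "u \<le> v"
  have "claim_integrand \<phi> u p \<le> claim_integrand \<phi> v p" for p
  proof (cases "0 \<le> fst p \<and> 0 \<le> snd p \<and> snd p \<le> U u (fst p)")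
    case True
    then have "U u (fst p) \<le> U v (fst p)" using uv U_mono by simp
    then show ?thesis
      using True mono_onD[OF assms(2), of "U u (fst p) - snd p" "U v (fst p) - snd p"]
      by (simp add: claim_integrand_def)
  next
    case False
    then have "claim_integrand \<phi> u p = 0" by (auto simp: claim_integrand_def)
    then show ?thesis using assms(1) by (auto simp: claim_integrand_def admissible_def)
  qed
  then have "(\<integral>p. claim_integrand \<phi> u p \<partial>P) \<le> (\<integral>p. claim_integrand \<phi> v p \<partial>P)"
    using uv assms(1) by (intro integral_mono integrable_claim_integrand) auto
  then show "A \<phi> u \<le> A \<phi> v"
    using uv by (simp add: risk_op_eq[OF assms(1)])
qed

lemma mono_on_funpow_risk_op:
  "admissible \<phi> \<Longrightarrow> mono_on {0..} \<phi> \<Longrightarrow> mono_on {0..} ((A ^^ k) \<phi>)"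
  by (induction k) (auto intro: mono_on_risk_op admissible_funpow_risk_op)

section \<open>Pointwise limits and iteration of the operator\<close>

lemma admissible_limit:
  assumes "\<And>k::nat. admissible (f k)" "\<And>x. 0 \<le> x \<Longrightarrow> (\<lambda>k. f k x) \<longlonglongrightarrow> \<phi> x"
  shows "admissible \<phi>"
  unfolding admissible_def
proof (intro conjI allI impI)
  show "\<phi> \<in> borel_measurable (restrict_space borel {0..})"
  proof (rule borel_measurable_LIMSEQ_real)
    show "(\<lambda>k. f k x) \<longlonglongrightarrow> \<phi> x" if "x \<in> space (restrict_space borel {0..})" for x
      using that assms(2) by (simp add: space_restrict_space)
    show "f k \<in> borel_measurable (restrict_space borel {0..})" for k
      using assms(1) by (simp add: admissible_def)
  qed
  fix u :: real assume "0 \<le> u"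
  then show "0 \<le> \<phi> u" "\<phi> u \<le> 1"
    using assms(1) by (auto simp: admissible_def
        intro!: LIMSEQ_le_const[OF assms(2), of u 0] LIMSEQ_le_const2[OF assms(2), of u 1])
qed

text \<open>Dominated convergence, with the constant 1 as dominating function.\<close>

lemma risk_op_tendsto:
  assumes f: "\<And>k::nat. admissible (f k)" and lim: "\<And>x. 0 \<le> x \<Longrightarrow> (\<lambda>k. f k x) \<longlonglongrightarrow> \<phi> x"
    and u: "0 \<le> u"
  shows "(\<lambda>k. A (f k) u) \<longlonglongrightarrow> A \<phi> u"
proof -
  have \<phi>: "admissible \<phi>" using f lim by (rule admissible_limit)
  show ?thesis
    unfolding risk_op_eq[OF f u] risk_op_eq[OF \<phi> u]
  proof (rule integral_dominated_convergence[where w = "\<lambda>_. 1"])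
    show "claim_integrand \<phi> u \<in> borel_measurable P" "claim_integrand (f k) u \<in> borel_measurable P" for k
      using f \<phi> u by (auto intro!: claim_integrand_measurable simp: admissible_def)
    show "AE p in P. (\<lambda>k. claim_integrand (f k) u p) \<longlonglongrightarrow> claim_integrand \<phi> u p"
      using lim by (intro AE_I2) (auto simp: claim_integrand_def)
    show "AE p in P. norm (claim_integrand (f k) u p) \<le> 1" for k
      using f[of k] by (intro AE_I2) (auto simp: claim_integrand_def admissible_def)
  qed auto
qed

text \<open>The sequence of images is the sequence of iterates shifted by one, so it tends both to
  \<open>A \<phi> u\<close> and to \<open>\<phi> u\<close>.\<close>

lemma risk_op_limit_fixed_point:
  assumes f: "admissible f" and lim: "\<And>x. 0 \<le> x \<Longrightarrow> (\<lambda>k. (A ^^ k) f x) \<longlonglongrightarrow> \<phi> x"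
    and u: "0 \<le> u"
  shows "\<phi> u = A \<phi> u"
proof -
  have "(\<lambda>k. A ((A ^^ k) f) u) \<longlonglongrightarrow> A \<phi> u"
    using admissible_funpow_risk_op[OF f] lim u by (rule risk_op_tendsto)
  moreover have "(\<lambda>k. A ((A ^^ k) f) u) \<longlonglongrightarrow> \<phi> u"
    using LIMSEQ_Suc[OF lim[OF u]] by simp
  ultimately show ?thesis by (rule LIMSEQ_unique[rotated])
qed

lemma funpow_risk_op_mono:
  assumes "admissible \<phi>" "admissible \<psi>" "\<And>x. 0 \<le> x \<Longrightarrow> \<phi> x \<le> \<psi> x" "0 \<le> u"
  shows "(A ^^ k) \<phi> u \<le> (A ^^ k) \<psi> u"
  using assms(4)
proof (induction k arbitrary: u)
  case (Suc k)
  then show ?case using assms by (auto intro!: risk_op_mono admissible_funpow_risk_op)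
qed (use assms in auto)

text \<open>Applying the monotone map \<open>A ^^ k\<close> to \<open>f \<le> A f\<close> compares
  consecutive iterates, because \<open>A ^^ k\<close> commutes with \<open>A\<close>.\<close>

lemma incseq_funpow_risk_op:
  assumes f: "admissible f" and sub: "\<And>x. 0 \<le> x \<Longrightarrow> f x \<le> A f x" and u: "0 \<le> u"
  shows "incseq (\<lambda>k. (A ^^ k) f u)"
proof (rule incseq_SucI)
  show "(A ^^ k) f u \<le> (A ^^ Suc k) f u" for k
    using funpow_risk_op_mono[OF f admissible_risk_op[OF f] sub u, of k]
    by (simp add: funpow_swap1)
qed

lemma decseq_funpow_risk_op:
  assumes f: "admissible f" and super: "\<And>x. 0 \<le> x \<Longrightarrow> A f x \<le> f x" and u: "0 \<le> u"
  shows "decseq (\<lambda>k. (A ^^ k) f u)"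
proof (rule decseq_SucI)
  show "(A ^^ Suc k) f u \<le> (A ^^ k) f u" for k
    using funpow_risk_op_mono[OF admissible_risk_op[OF f] f super u, of k]
    by (simp add: funpow_swap1)
qed

section \<open>Loss in one step on a favourable event\<close>

lemma measure_P_Times:
  assumes "S \<in> sets borel" "R \<in> sets borel"
  shows "measure P (S \<times> R) = measure (interval_measure K) S * measure (interval_measure F) R"
  using assms F.emeasure_pair_measure_Times[of S "interval_measure K" R]
  by (simp add: P.emeasure_eq_measure K.emeasure_eq_measure F.emeasure_eq_measure
      ennreal_mult[symmetric] del: F.emeasure_pair_measure_Times)

text \<open>The integrand is at most \<open>s\<close> everywhere and at most \<open>s / 2\<close> on
  \<open>E\<close>, so its mean falls below \<open>s\<close> by at least half of \<open>s\<close>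
  times the mass of \<open>E\<close>. The event will be ruin or escape to large reserves.\<close>

lemma risk_op_contraction:
  assumes \<delta>: "admissible \<delta>" and le: "\<And>x. 0 \<le> x \<Longrightarrow> \<delta> x \<le> s"
    and s: "0 \<le> s" and u: "0 \<le> u" and E: "E \<in> sets P"
    and small: "\<And>p. p \<in> E \<Longrightarrow> claim_integrand \<delta> u p \<le> s / 2"
  shows "A \<delta> u \<le> s - s / 2 * measure P E"
proof -
  have "(\<integral>p. claim_integrand \<delta> u p \<partial>P) \<le> (\<integral>p. s - s / 2 * indicator E p \<partial>P)"
  proof (intro integral_mono integrable_claim_integrand \<delta> u)
    show "integrable P (\<lambda>p. s - s / 2 * indicator E p)"
      using E by (auto intro!: integrable_real_indicator simp: P.emeasure_eq_measure)
    show "claim_integrand \<delta> u p \<le> s - s / 2 * indicator E p" for p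
      using small[of p] le s by (cases "p \<in> E") (auto simp: claim_integrand_def)
  qed
  also have "\<dots> = s - s / 2 * measure P E"
    using E by (subst Bochner_Integration.integral_diff)
      (auto intro!: integrable_real_indicator simp: P.emeasure_eq_measure P.prob_space)
  finally show ?thesis by (simp add: risk_op_eq[OF \<delta> u])
qed

end

section \<open>Uniqueness of fixed points with limit one\<close>

locale risk_model_growth = risk_model +
  assumes U_mono_time: "\<And>u t t'. 0 \<le> u \<Longrightarrow> 0 \<le> t \<Longrightarrow> t \<le> t' \<Longrightarrow> U u t \<le> U u t'"
    and U_lim: "\<And>u. 0 \<le> u \<Longrightarrow> filterlim (U u) at_top at_top"
    and KF: "\<And>t z. 0 \<le> t \<Longrightarrow> 0 \<le> z \<Longrightarrow> K t * F z < 1"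
begin

text \<open>A maximum principle: a positive supremum \<open>s\<close> would be improved to
  \<open>s - s / 2 * q\<close> at every point, with the same \<open>q > 0\<close>
  throughout.\<close>

lemma subsolution_vanishes:
  assumes \<delta>: "admissible \<delta>" and lim: "(\<delta> \<longlongrightarrow> 0) at_top"
    and sub: "\<And>x. 0 \<le> x \<Longrightarrow> \<delta> x \<le> A \<delta> x" and x: "0 \<le> x"
  shows "\<delta> x \<le> 0"
proof (rule ccontr)
  assume "\<not> \<delta> x \<le> 0"
  define s where "s = (SUP y\<in>{0..}. \<delta> y)"
  have bdd: "bdd_above (\<delta> ` {0..})"
    using \<delta> by (auto simp: admissible_def intro!: bdd_aboveI[where M = 1])
  have le: "\<delta> y \<le> s" if "0 \<le> y" for y
    unfolding s_def using that bdd by (auto intro: cSUP_upper)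
  have s: "0 < s" using le[OF x] \<open>\<not> \<delta> x \<le> 0\<close> by linarith
  have "\<forall>\<^sub>F y in at_top. \<delta> y < s / 2"
    using order_tendstoD(2)[OF lim, of "s / 2"] s by simp
  then obtain B0 where B0: "\<And>y. B0 \<le> y \<Longrightarrow> \<delta> y < s / 2"
    by (auto simp: eventually_at_top_linorder)
  \<comment> \<open>The maximum with 0 makes \<open>B\<close> a legitimate initial reserve for the
    flow.\<close>
  define B where "B = max 0 B0"
  have B: "0 \<le> B" "\<And>y. B \<le> y \<Longrightarrow> \<delta> y \<le> s / 2"
    using B0 by (auto simp: B_def less_imp_le)
  \<comment> \<open>A single event must serve all initial reserves in \<open>{0..B}\<close>, so that
    the loss is uniform in \<open>u\<close>.\<close>
  have "\<exists>q>0. \<exists>E\<in>sets P. q \<le> measure P E \<and>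
      (\<forall>u. 0 \<le> u \<longrightarrow> u \<le> B \<longrightarrow> (\<forall>p\<in>E. claim_integrand \<delta> u p \<le> s / 2))"
  proof (cases "\<forall>z\<ge>0. F z < 1")
    case True
    obtain t0 where t0: "0 \<le> t0" "0 < K t0" using distribution_function_pos[OF K_dist] .
    \<comment> \<open>Up to time \<open>t0\<close> no reserve starting in \<open>{0..B}\<close>
      exceeds \<open>U B t0\<close>, so a larger claim means ruin. Negative times belong to the
      event as well, but there the integrand is 0.\<close>
    let ?E = "{..t0} \<times> {U B t0<..}"
    have "measure P ?E = K t0 * (1 - F (U B t0))"
      by (simp add: measure_P_Times measure_distribution_function_Iic[OF K_dist]
          measure_distribution_function_Ioi[OF F_dist])
    moreover have "0 < K t0 * (1 - F (U B t0))"
      using t0 True U_nonneg[OF B(1) t0(1)] by simp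
    moreover have "claim_integrand \<delta> u p \<le> s / 2" if "0 \<le> u" "u \<le> B" "p \<in> ?E" for u p
    proof -
      have "U u (fst p) \<le> U B t0" if "0 \<le> fst p"
        using U_mono[of u B "fst p"] U_mono_time[of B "fst p" t0] \<open>p \<in> ?E\<close> \<open>0 \<le> u\<close> \<open>u \<le> B\<close> B that
        by auto
      then show ?thesis using that s by (auto simp: claim_integrand_def)
    qed
    moreover have "?E \<in> sets P" by auto
    ultimately show ?thesis by (metis order_refl)
  next
    case False
    \<comment> \<open>Claims are bounded in this case: \<open>F z0 = 1\<close>, and then
      \<open>K t * F z0 < 1\<close> forces \<open>K t < 1\<close> for every
      \<open>t \<ge> 0\<close>.\<close>
    then obtain z0 where "0 \<le> z0" "F z0 = 1"
      using distribution_function_le_1[OF F_dist] by (metis order.antisym not_le)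
    then have K1: "K t < 1" if "0 \<le> t" for t using KF[OF that, of z0] by simp
    obtain z1 where z1: "0 \<le> z1" "0 < F z1" using distribution_function_pos[OF F_dist] .
    \<comment> \<open>Choose a time by which even reserve 0 has grown to \<open>B + z1\<close>. By
      monotonicity of the flow, any later claim of size at most \<open>z1\<close> leaves at least
      \<open>B\<close>, where \<open>\<delta> \<le> s / 2\<close>.\<close>
    have "\<forall>\<^sub>F t in at_top. B + z1 \<le> U 0 t"
      using U_lim[of 0] by (simp add: filterlim_at_top)
    then have "\<forall>\<^sub>F t in at_top. 0 \<le> t \<and> B + z1 \<le> U 0 t"
      using eventually_ge_at_top[of 0] by eventually_elim auto
    then obtain t1 where t1: "0 \<le> t1" "B + z1 \<le> U 0 t1"
      using eventually_happens'[OF trivial_limit_at_top_linorder] by blast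
    let ?E = "{t1<..} \<times> {..z1}"
    have "measure P ?E = (1 - K t1) * F z1"
      by (simp add: measure_P_Times measure_distribution_function_Iic[OF F_dist]
          measure_distribution_function_Ioi[OF K_dist])
    moreover have "0 < (1 - K t1) * F z1" using K1[OF t1(1)] z1 by simp
    moreover have "claim_integrand \<delta> u p \<le> s / 2" if "0 \<le> u" "u \<le> B" "p \<in> ?E" for u p
    proof -
      have "B + z1 \<le> U u (fst p)"
        using U_mono[of 0 u "fst p"] U_mono_time[of 0 t1 "fst p"] that t1 by auto
      then have "B \<le> U u (fst p) - snd p" using that(3) by auto
      then show ?thesis using s by (auto simp: claim_integrand_def dest: B(2))
    qed
    moreover have "?E \<in> sets P" by auto
    ultimately show ?thesis by (metis order_refl)
  qed
  then obtain q E where q: "0 < q" and E: "E \<in> sets P" "q \<le> measure P E"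
    and small: "\<And>u p. 0 \<le> u \<Longrightarrow> u \<le> B \<Longrightarrow> p \<in> E \<Longrightarrow> claim_integrand \<delta> u p \<le> s / 2"
    by blast
  have "\<delta> u \<le> s - s / 2 * q" if u: "0 \<le> u" for u
  proof (cases "u \<le> B")
    case True
    have "\<delta> u \<le> s - s / 2 * measure P E"
      using sub[OF u] risk_op_contraction[OF \<delta> le _ u E(1) small] s u True by force
    also have "\<dots> \<le> s - s / 2 * q" using E s by (simp add: mult_left_mono)
    finally show ?thesis .
  next
    case False
    \<comment> \<open>As \<open>q\<close> is at most a probability, the bound \<open>s / 2\<close>
      beyond \<open>B\<close> is no larger than \<open>s - s / 2 * q\<close>.\<close>
    have "q \<le> 1" using E(2) P.prob_le_1[of E] by linarith
    then have "s / 2 * q \<le> s / 2" using s by (simp add: mult_left_le)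
    then show ?thesis using B(2)[of u] False by linarith
  qed
  then have "s \<le> s - s / 2 * q" unfolding s_def by (intro cSUP_least) (auto simp: s_def[symmetric])
  moreover have "0 < s / 2 * q" using s q by simp
  ultimately show False by linarith
qed

text \<open>The distance of two fixed points is a subsolution by linearity and the triangle
  inequality for integrals, and it tends to 0 because both limits are 1.\<close>

lemma fixed_point_unique:
  assumes \<phi>: "admissible \<phi>" "\<And>x. 0 \<le> x \<Longrightarrow> \<phi> x = A \<phi> x" "(\<phi> \<longlongrightarrow> 1) at_top"
    and \<psi>: "admissible \<psi>" "\<And>x. 0 \<le> x \<Longrightarrow> \<psi> x = A \<psi> x" "(\<psi> \<longlongrightarrow> 1) at_top"
    and u: "0 \<le> u"
  shows "\<phi> u = \<psi> u"
proof -
  define \<delta> where "\<delta> x = \<bar>\<phi> x - \<psi> x\<bar>" for x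
  have \<delta>: "admissible \<delta>"
    unfolding admissible_def
  proof (intro conjI allI impI)
    have [measurable]: "\<phi> \<in> borel_measurable (restrict_space borel {0..})"
      "\<psi> \<in> borel_measurable (restrict_space borel {0..})"
      using \<phi>(1) \<psi>(1) by (auto simp: admissible_def)
    show "\<delta> \<in> borel_measurable (restrict_space borel {0..})"
      unfolding \<delta>_def by measurable
    fix x :: real assume "0 \<le> x"
    then have "0 \<le> \<phi> x" "\<phi> x \<le> 1" "0 \<le> \<psi> x" "\<psi> x \<le> 1"
      using \<phi>(1) \<psi>(1) unfolding admissible_def by blast+
    then show "0 \<le> \<delta> x" "\<delta> x \<le> 1" by (auto simp: \<delta>_def)
  qed
  have "\<delta> u \<le> 0"
  proof (rule subsolution_vanishes[OF \<delta> _ _ u])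
    show "(\<delta> \<longlongrightarrow> 0) at_top"
      unfolding \<delta>_def using tendsto_rabs[OF tendsto_diff[OF \<phi>(3) \<psi>(3)]] by simp
    fix x :: real assume x: "0 \<le> x"
    have "\<phi> x - \<psi> x = (\<integral>p. claim_integrand \<phi> x p - claim_integrand \<psi> x p \<partial>P)"
      using \<phi> \<psi> x by (subst Bochner_Integration.integral_diff)
        (auto intro: integrable_claim_integrand simp: risk_op_eq[symmetric])
    then have "\<delta> x \<le> (\<integral>p. \<bar>claim_integrand \<phi> x p - claim_integrand \<psi> x p\<bar> \<partial>P)"
      unfolding \<delta>_def by (simp only: integral_abs_bound)
    \<comment> \<open>Both integrands are cut off on the same ruin set, so taking the distance
      commutes with forming the integrand.\<close>
    moreover have "(\<lambda>p. \<bar>claim_integrand \<phi> x p - claim_integrand \<psi> x p\<bar>) = claim_integrand \<delta> x"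
      by (rule ext) (simp add: claim_integrand_def \<delta>_def)
    ultimately show "\<delta> x \<le> A \<delta> x"
      by (simp add: risk_op_eq[OF \<delta> x])
  qed
  then show ?thesis by (simp add: \<delta>_def)
qed

end

section \<open>The exponential lower bound as a subsolution\<close>

lemma (in risk_model) phi_star_subsolution:
  assumes "\<And>z. z < 0 \<Longrightarrow> F z = 0" "\<And>t. t < 0 \<Longrightarrow> K t = 0"
    and "0 \<le> u\<^sub>0" "0 < L"
    and growth: "\<And>u t. u\<^sub>0 \<le> u \<Longrightarrow> 0 \<le> t \<Longrightarrow> u + c\<^sub>0 * t \<le> U u t"
    and moment: "(\<integral>\<^sup>+z\<in>{0..}. ennreal (exp (L * z)) \<partial>interval_measure F) *
            (\<integral>\<^sup>+t\<in>{0..}. ennreal (exp (- c\<^sub>0 * L * t)) \<partial>interval_measure K) \<le> 1"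
    and adm: "admissible (phi_star L u\<^sub>0)" and u: "0 \<le> u"
  shows "phi_star L u\<^sub>0 u \<le> A (phi_star L u\<^sub>0) u"
proof (cases "u\<^sub>0 \<le> u")
  case False
  then have "phi_star L u\<^sub>0 u = 0" using \<open>0 < L\<close> by (simp add: phi_star_def mult_le_0_iff)
  then show ?thesis using admissible_risk_op[OF adm] u by (simp add: admissible_def)
next
  case True
  let ?h = "claim_integrand (phi_star L u\<^sub>0) u"
  let ?e = "exp (- L * (u - u\<^sub>0))"
  let ?f = "\<lambda>z. ennreal (exp (L * z)) * indicator {0..} z"
  let ?k = "\<lambda>t. ennreal (exp (- c\<^sub>0 * L * t)) * indicator {0..} t"
  have int: "integrable P ?h" using adm u by (rule integrable_claim_integrand)
  have h_le: "?h p \<le> 1" for p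
    using adm by (auto simp: claim_integrand_def admissible_def)
  have nonneg: "AE t in interval_measure K. 0 \<le> t" "AE z in interval_measure F. 0 \<le> z"
    using AE_distribution_function_nonneg[OF K_dist] AE_distribution_function_nonneg[OF F_dist] assms(1,2) by auto
  from nonneg(1) have "AE t in interval_measure K. AE z in interval_measure F. 0 \<le> t \<and> 0 \<le> z"
  proof eventually_elim
    case (elim t)
    then show ?case using nonneg(2) by simp
  qed
  \<comment> \<open>The pointwise estimate needs nonnegative time and claim. Almost surely both
    hold, and then the indicators in \<open>?f\<close> and \<open>?k\<close> equal 1.\<close>
  then have AE: "AE p in P. 0 \<le> fst p \<and> 0 \<le> snd p"
  proof (intro AE_pair_measure)
    have "{p \<in> space P. 0 \<le> fst p \<and> 0 \<le> snd p} = {0..} \<times> {0..}"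
      by (auto simp: space_P)
    then show "{p \<in> space P. 0 \<le> fst p \<and> 0 \<le> snd p} \<in> sets P" by simp
  qed simp
  \<comment> \<open>The defect of \<open>phi_star\<close> is at most an exponential in the reserve
    after the claim. Linear growth of the flow then splits this into a factor in \<open>u\<close>,
    one in time and one in the claim.\<close>
  have bound: "1 - ?h p \<le> ?e * (exp (- c\<^sub>0 * L * fst p) * exp (L * snd p))"
    if "0 \<le> fst p" "0 \<le> snd p" for p
  proof -
    let ?x = "U u (fst p) - snd p"
    have "1 - ?h p \<le> exp (- L * (?x - u\<^sub>0))"
    proof (cases "snd p \<le> U u (fst p)")
      case True
      then show ?thesis using that by (auto simp: claim_integrand_def phi_star_def)
    next
      case False
      \<comment> \<open>At ruin the defect is 1, and the exponential covers it because the reserve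
        after the claim is negative while \<open>u\<^sub>0\<close> is not.\<close>
      then have "1 \<le> exp (- L * (?x - u\<^sub>0))"
        using \<open>0 < L\<close> \<open>0 \<le> u\<^sub>0\<close> by (simp add: mult_le_0_iff)
      then show ?thesis using False by (simp add: claim_integrand_def)
    qed
    also have "\<dots> \<le> exp (- L * (u + c\<^sub>0 * fst p - snd p - u\<^sub>0))"
      using growth[OF True that(1)] \<open>0 < L\<close> by (simp add: mult_left_mono)
    also have "\<dots> = ?e * (exp (- c\<^sub>0 * L * fst p) * exp (L * snd p))"
      by (simp add: exp_add[symmetric] algebra_simps)
    finally show ?thesis .
  qed
  have [measurable]: "?f \<in> borel_measurable (interval_measure F)" "?k \<in> borel_measurable (interval_measure K)"
    by measurable
  have kf_meas: "(\<lambda>p. ?k (fst p) * ?f (snd p)) \<in> borel_measurable P"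
    by measurable
  \<comment> \<open>With extended nonnegative integrals, Tonelli factors the bound into the two
    moments without knowing beforehand that either is finite.\<close>
  have "ennreal (\<integral>p. 1 - ?h p \<partial>P) = (\<integral>\<^sup>+p. ennreal (1 - ?h p) \<partial>P)"
    using int h_le by (intro nn_integral_eq_integral[symmetric]) auto
  also have "\<dots> \<le> (\<integral>\<^sup>+p. ennreal ?e * (?k (fst p) * ?f (snd p)) \<partial>P)"
    using AE
  proof (intro nn_integral_mono_AE, eventually_elim)
    case (elim p)
    then have "ennreal (1 - ?h p) \<le> ennreal (?e * (exp (- c\<^sub>0 * L * fst p) * exp (L * snd p)))"
      using bound by (intro ennreal_leI) auto
    then show ?case using elim by (simp add: ennreal_mult)
  qed
  also have "\<dots> = ennreal ?e * (\<integral>\<^sup>+p. ?k (fst p) * ?f (snd p) \<partial>P)"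
    by (intro nn_integral_cmult kf_meas)
  also have "(\<integral>\<^sup>+p. ?k (fst p) * ?f (snd p) \<partial>P)
      = (\<integral>\<^sup>+t. \<integral>\<^sup>+z. ?k t * ?f z \<partial>interval_measure F \<partial>interval_measure K)"
    using F.nn_integral_fst[OF kf_meas] by simp
  also have "\<dots> = (\<integral>\<^sup>+t. ?k t * (\<integral>\<^sup>+z. ?f z \<partial>interval_measure F) \<partial>interval_measure K)"
    by (intro nn_integral_cong nn_integral_cmult) measurable
  also have "\<dots> = (\<integral>\<^sup>+z. ?f z \<partial>interval_measure F) * (\<integral>\<^sup>+t. ?k t \<partial>interval_measure K)"
    by (subst mult.commute) (rule nn_integral_multc, measurable)
  also have "ennreal ?e * \<dots> \<le> ennreal ?e * 1"
    using moment by (intro mult_left_mono) auto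
  finally have "(\<integral>p. 1 - ?h p \<partial>P) \<le> ?e"
    by (simp add: ennreal_le_iff)
  also have "(\<integral>p. 1 - ?h p \<partial>P) = 1 - A (phi_star L u\<^sub>0) u"
    using int by (simp add: risk_op_eq[OF adm u] P.prob_space)
  finally have "1 - ?e \<le> A (phi_star L u\<^sub>0) u" by simp
  then show ?thesis
    using admissible_risk_op[OF adm] u by (simp add: phi_star_def admissible_def)
qed

section \<open>Existence, uniqueness and convergence of the iterations\<close>

theorem theorem5p1:
  fixes F K c :: "real \<Rightarrow> real" and U :: "real \<Rightarrow> real \<Rightarrow> real" and u\<^sub>0 c\<^sub>0 L :: real
  assumes F: "distribution_function F" "\<forall>z\<le>0. F z = 0"
    and K: "distribution_function K" "\<forall>t<0. K t = 0"
    and c: "piecewise_continuous c" "\<forall>x\<ge>0. c x \<ge> 0"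
    and U: "reserve_flow c U"
    and a: "\<forall>t\<ge>0. mono_on {0..} (\<lambda>u. U u t)"
           "\<forall>u\<ge>0. mono_on {0..} (\<lambda>t. U u t)"
           "\<forall>u\<ge>0. filterlim (\<lambda>t. U u t) at_top at_top"
    and b: "u\<^sub>0 \<ge> 0" "c\<^sub>0 > 0" "L > 0"
           "\<forall>u\<ge>u\<^sub>0. \<forall>t\<ge>0. U u t \<ge> u + c\<^sub>0 * t"
           "(\<integral>\<^sup>+z\<in>{0..}. ennreal (exp (L * z)) \<partial>interval_measure F) *
            (\<integral>\<^sup>+t\<in>{0..}. ennreal (exp (- c\<^sub>0 * L * t)) \<partial>interval_measure K) \<le> 1"
    and cc: "\<forall>t\<ge>0. \<forall>z\<ge>0. K t * F z < 1"
  shows "\<exists>\<phi> :: real \<Rightarrow> real.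
    \<comment> \<open>1)\<close>
    (mono_on {0..} \<phi> \<and> (\<forall>u\<ge>0. \<phi> u = risk_op F K U \<phi> u) \<and>
     (\<forall>u\<ge>0. phi_star L u\<^sub>0 u \<le> \<phi> u \<and> \<phi> u \<le> 1)) \<and>
    \<comment> \<open>2)\<close>
    (\<phi> \<longlongrightarrow> 1) at_top \<and>
    (\<forall>\<psi> :: real \<Rightarrow> real.
       mono_on {0..} \<psi> \<and> (\<forall>u\<ge>0. 0 \<le> \<psi> u \<and> \<psi> u \<le> 1) \<and>
       (\<forall>u\<ge>0. \<psi> u = risk_op F K U \<psi> u) \<and> (\<psi> \<longlongrightarrow> 1) at_top
       \<longrightarrow> (\<forall>u\<ge>0. \<psi> u = \<phi> u)) \<and>
    \<comment> \<open>3)\<close>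
    (\<forall>u\<ge>0. decseq (\<lambda>k. (risk_op F K U ^^ k) (\<lambda>_. 1) u) \<and>
            (\<lambda>k. (risk_op F K U ^^ k) (\<lambda>_. 1) u) \<longlonglongrightarrow> \<phi> u) \<and>
    (\<forall>u\<ge>0. incseq (\<lambda>k. (risk_op F K U ^^ k) (phi_star L u\<^sub>0) u) \<and>
            (\<lambda>k. (risk_op F K U ^^ k) (phi_star L u\<^sub>0) u) \<longlonglongrightarrow> \<phi> u) \<and>
    \<comment> \<open>4)\<close>
    (\<forall>\<phi>\<^sub>0 :: real \<Rightarrow> real.
       \<phi>\<^sub>0 \<in> borel_measurable (restrict_space borel {0..}) \<and>
       (\<forall>u\<ge>0. phi_star L u\<^sub>0 u \<le> \<phi>\<^sub>0 u \<and> \<phi>\<^sub>0 u \<le> 1)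
       \<longrightarrow> (\<forall>u\<ge>0. (\<lambda>k. (risk_op F K U ^^ k) \<phi>\<^sub>0 u) \<longlonglongrightarrow> \<phi> u))"
proof -
  have sol: "cauchy_solution c u (U u)" if "0 \<le> u" for u
    using U that by (simp add: reserve_flow_def)
  interpret risk_model_growth F K U
  proof
    show "distribution_function F" "distribution_function K" using F K by auto
    show "0 \<le> U u t" if "0 \<le> u" "0 \<le> t" for u t
      using sol[OF that(1)] that by (simp add: cauchy_solution_def)
    show "continuous_on {0..} (U u)" if "0 \<le> u" for u
      using sol[OF that] by (simp add: cauchy_solution_def)
    show "U u t \<le> U v t" if "0 \<le> u" "u \<le> v" "0 \<le> t" for u v t
      using mono_onD[OF a(1)[rule_format, OF that(3)], of u v] that by simp
    show "U u t \<le> U u t'" if "0 \<le> u" "0 \<le> t" "t \<le> t'" for u t t'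
      using mono_onD[OF a(2)[rule_format, OF that(1)], of t t'] that by simp
    show "filterlim (U u) at_top at_top" if "0 \<le> u" for u
      using a(3) that by auto
    show "K t * F z < 1" if "0 \<le> t" "0 \<le> z" for t z
      using cc that by auto
  qed
  let ?s = "phi_star L u\<^sub>0"
  have s_mono: "mono ?s"
  proof (rule monoI)
    fix x y :: real assume "x \<le> y"
    then have "- L * (y - u\<^sub>0) \<le> - L * (x - u\<^sub>0)" using b(3) by simp
    then have "exp (- L * (y - u\<^sub>0)) \<le> exp (- L * (x - u\<^sub>0))" by (rule exp_le_cancel_iff[THEN iffD2])
    then show "?s x \<le> ?s y" unfolding phi_star_def by linarith
  qed
  have s_adm: "admissible ?s"
    using borel_measurable_mono[OF s_mono]
    by (auto simp: admissible_def phi_star_def intro: measurable_restrict_space1)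
  have one_adm: "admissible (\<lambda>_. 1)" by (simp add: admissible_def)
  have s_lim: "(?s \<longlongrightarrow> 1) at_top"
  proof -
    have "filterlim (\<lambda>x. L * (x - u\<^sub>0)) at_top at_top"
      using b(3) by (intro filterlim_tendsto_pos_mult_at_top[OF tendsto_const])
        (use filterlim_tendsto_add_at_top[OF tendsto_const filterlim_ident, of "- u\<^sub>0"] in simp_all)
    then have "((\<lambda>x. exp (- (L * (x - u\<^sub>0)))) \<longlongrightarrow> 0) at_top"
      by (intro filterlim_compose[OF exp_at_bot] filterlim_compose[OF filterlim_uminus_at_bot_at_top])
    then have "((\<lambda>x. max 0 (1 - exp (- (L * (x - u\<^sub>0))))) \<longlongrightarrow> max 0 (1 - 0)) at_top"
      by (intro tendsto_intros)
    then show ?thesis by (simp add: phi_star_def[abs_def])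
  qed
  have s_sub: "?s u \<le> A ?s u" if "0 \<le> u" for u
    using F(2) K(2) b s_adm that by (intro phi_star_subsolution[where c\<^sub>0 = c\<^sub>0]) auto
  have dec: "decseq (\<lambda>k. (A ^^ k) (\<lambda>_. 1) u)" if "0 \<le> u" for u
    using admissible_risk_op[OF one_adm] that
    by (intro decseq_funpow_risk_op one_adm) (auto simp: admissible_def)
  have inc: "incseq (\<lambda>k. (A ^^ k) ?s u)" if "0 \<le> u" for u
    using s_adm s_sub that by (rule incseq_funpow_risk_op)
  have range: "0 \<le> (A ^^ k) f u \<and> (A ^^ k) f u \<le> 1" if "admissible f" "0 \<le> u" for f k u
    using admissible_funpow_risk_op[OF that(1), of k] that(2) by (simp add: admissible_def)
  define \<phi> where "\<phi> u = lim (\<lambda>k. (A ^^ k) (\<lambda>_. 1) u)" for u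
  define \<theta> where "\<theta> u = lim (\<lambda>k. (A ^^ k) ?s u)" for u
  have \<phi>: "(\<lambda>k. (A ^^ k) (\<lambda>_. 1) u) \<longlonglongrightarrow> \<phi> u" if "0 \<le> u" for u
    unfolding \<phi>_def convergent_LIMSEQ_iff[symmetric]
    by (rule decseq_convergent[OF dec[OF that], of 0])
      (use range[OF one_adm that] in \<open>auto simp: convergent_def\<close>)
  have \<theta>: "(\<lambda>k. (A ^^ k) ?s u) \<longlonglongrightarrow> \<theta> u" if "0 \<le> u" for u
    unfolding \<theta>_def convergent_LIMSEQ_iff[symmetric]
    by (rule incseq_convergent[OF inc[OF that], of 1])
      (use range[OF s_adm that] in \<open>auto simp: convergent_def\<close>)
  have \<phi>_adm: "admissible \<phi>"
    using admissible_funpow_risk_op[OF one_adm] \<phi> by (rule admissible_limit)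
  have \<theta>_adm: "admissible \<theta>"
    using admissible_funpow_risk_op[OF s_adm] \<theta> by (rule admissible_limit)
  have s_le_\<theta>: "?s u \<le> \<theta> u" if "0 \<le> u" for u
    using incseq_le[OF inc[OF that] \<theta>[OF that], of 0] by simp
  have \<theta>_le_\<phi>: "\<theta> u \<le> \<phi> u" if "0 \<le> u" for u
    using s_adm one_adm that
    by (intro LIMSEQ_le[OF \<theta> \<phi>] exI[of _ 0] allI impI funpow_risk_op_mono) (auto simp: admissible_def)
  have lim_1: "(f \<longlongrightarrow> 1) at_top" if "admissible f" "\<And>u. 0 \<le> u \<Longrightarrow> ?s u \<le> f u" for f
  proof (rule tendsto_sandwich[OF _ _ s_lim tendsto_const])
    show "\<forall>\<^sub>F u in at_top. ?s u \<le> f u" "\<forall>\<^sub>F u in at_top. f u \<le> 1"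
      using that by (auto simp: admissible_def intro!: eventually_mono[OF eventually_ge_at_top[of 0]])
  qed
  have \<phi>_fix: "\<phi> u = A \<phi> u" if "0 \<le> u" for u
    using one_adm \<phi> that by (rule risk_op_limit_fixed_point)
  have \<theta>_fix: "\<theta> u = A \<theta> u" if "0 \<le> u" for u
    using s_adm \<theta> that by (rule risk_op_limit_fixed_point)
  have s_le_\<phi>: "?s u \<le> \<phi> u" if "0 \<le> u" for u
    using s_le_\<theta>[OF that] \<theta>_le_\<phi>[OF that] by simp
  have \<phi>_lim: "(\<phi> \<longlongrightarrow> 1) at_top" using \<phi>_adm s_le_\<phi> by (rule lim_1)
  have \<theta>_eq: "\<theta> u = \<phi> u" if "0 \<le> u" for u
    by (rule fixed_point_unique[OF \<theta>_adm \<theta>_fix lim_1[OF \<theta>_adm s_le_\<theta>] \<phi>_adm \<phi>_fix \<phi>_lim that])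
  show ?thesis
  proof (intro exI[of _ \<phi>] conjI allI impI)
    show "mono_on {0..} \<phi>"
      using mono_on_funpow_risk_op[OF one_adm] \<phi> by (rule mono_on_limit) (auto intro: mono_onI)
    show "\<phi> u = A \<phi> u" if "0 \<le> u" for u using \<phi>_fix that .
    show "?s u \<le> \<phi> u" if "0 \<le> u" for u using s_le_\<phi> that .
    show "\<phi> u \<le> 1" if "0 \<le> u" for u using \<phi>_adm that by (simp add: admissible_def)
    show "(\<phi> \<longlongrightarrow> 1) at_top" by (rule \<phi>_lim)
    show "decseq (\<lambda>k. (A ^^ k) (\<lambda>_. 1) u)" if "0 \<le> u" for u using dec that .
    show "(\<lambda>k. (A ^^ k) (\<lambda>_. 1) u) \<longlonglongrightarrow> \<phi> u" if "0 \<le> u" for u using \<phi> that .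
    show "incseq (\<lambda>k. (A ^^ k) ?s u)" if "0 \<le> u" for u using inc that .
    show "(\<lambda>k. (A ^^ k) ?s u) \<longlonglongrightarrow> \<phi> u" if "0 \<le> u" for u using \<theta>[OF that] \<theta>_eq[OF that] by simp
  next
    fix \<psi> :: "real \<Rightarrow> real" and u :: real
    assume \<psi>: "mono_on {0..} \<psi> \<and> (\<forall>u\<ge>0. 0 \<le> \<psi> u \<and> \<psi> u \<le> 1) \<and>
       (\<forall>u\<ge>0. \<psi> u = A \<psi> u) \<and> (\<psi> \<longlongrightarrow> 1) at_top" and u: "0 \<le> u"
    have "admissible \<psi>"
      using \<psi> by (auto simp: admissible_def intro: borel_measurable_mono_on_fnc)
    then show "\<psi> u = \<phi> u"
      using \<psi> by (intro fixed_point_unique[OF _ _ _ \<phi>_adm \<phi>_fix \<phi>_lim u]) auto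
  next
    fix \<phi>\<^sub>0 :: "real \<Rightarrow> real" and u :: real
    assume \<phi>\<^sub>0: "\<phi>\<^sub>0 \<in> borel_measurable (restrict_space borel {0..}) \<and>
       (\<forall>u\<ge>0. ?s u \<le> \<phi>\<^sub>0 u \<and> \<phi>\<^sub>0 u \<le> 1)" and u: "0 \<le> u"
    have "0 \<le> ?s x" for x by (simp add: phi_star_def)
    then have adm: "admissible \<phi>\<^sub>0"
      using \<phi>\<^sub>0 by (auto simp: admissible_def intro: order_trans)
    show "(\<lambda>k. (A ^^ k) \<phi>\<^sub>0 u) \<longlonglongrightarrow> \<phi> u"
    proof (rule tendsto_sandwich[OF _ _ \<theta>[OF u, unfolded \<theta>_eq[OF u]] \<phi>[OF u]])
      show "\<forall>\<^sub>F k in sequentially. (A ^^ k) ?s u \<le> (A ^^ k) \<phi>\<^sub>0 u"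
        "\<forall>\<^sub>F k in sequentially. (A ^^ k) \<phi>\<^sub>0 u \<le> (A ^^ k) (\<lambda>_. 1) u"
        using \<phi>\<^sub>0 u by (auto intro!: always_eventually funpow_risk_op_mono s_adm adm one_adm)
    qed
  qed
qed

end
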